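(* Let $D\subset\mathbb{R}^m$ be open and convex, let $F:D\to\mathbb{R}^m$ have continuous derivatives up to order four on $D$, and let $\alpha\in D$ satisfy $F(\alpha)=0$ with $F'(\alpha)$ nonsingular. For $x$ near $\alpha$ define $$y=x-[x+F(x),x-F(x);F]^{-1}F(x),\qquad z=y-\nu\,F(y),$$ $$\nu=\bigl(2[y,x;F]-[x+F(x),x-F(x);F]\bigr)^{-1}.$$ Then the iterative method $x\mapsto z$ has local order of convergence at least four at $\alpha$. With $e=x-\alpha$ and $\widetilde e=F'(\alpha)e$, its vectorial error equation is, as $x\to\alpha$, $$z-\alpha=A_2\bigl(A_2(e,e),A_2(e,e)\bigr)-A_3\bigl(e,e,A_2(e,e)\bigr)-A_3\bigl(\widetilde e,\widetilde e,A_2(e,e)\bigr)+O(\|e\|^5).$$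
   Context: The first divided difference operator of $F$ is the matrix-valued map given by $[u,v;F]=\int_0^1F'(v+t(u-v))\,dt$ for $u,v\in D$ (by definition also when $u=v$). For $p=2,3$, $A_p=\frac1{p!}F'(\alpha)^{-1}F^{(p)}(\alpha)$, a symmetric $p$-linear map $(\mathbb{R}^m)^p\to\mathbb{R}^m$. For $x$ sufficiently close to $\alpha$, all the points involved lie in $D$ and all the inverses involved exist. An iterative method $x_{n+1}=\Phi(x_n)$ has local order of convergence at least $p$ at $\alpha$ if, for $x_0$ sufficiently close to $\alpha$, the iterates are well defined and converge to $\alpha$, and there is a constant $C$ with $\|x_{n+1}-\alpha\|\le C\|x_n-\alpha\|^p$ for all $n$. *)

theory Defs
  imports "HOL-Analysis.Analysis" "HOL-Library.Landau_Symbols"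
begin

text \<open>
  The Frechet derivative as a map into the normed space of bounded linear maps, so that it can
  be iterated: \<open>fderiv (fderiv F) a u v\<close> is \<open>F''(a)(u,v)\<close>.  Wherever \<open>F\<close> is
  differentiable, \<open>frechet_derivative F (at x)\<close> is bounded linear and \<open>Blinfun\<close> loses nothing.
\<close>

definition fderiv ::
  "('a::real_normed_vector \<Rightarrow> 'b::real_normed_vector) \<Rightarrow> 'a \<Rightarrow> ('a \<Rightarrow>\<^sub>L 'b)" where
  "fderiv F x = Blinfun (frechet_derivative F (at x))"

definition C1_on ::
  "'a::real_normed_vector set \<Rightarrow> ('a \<Rightarrow> 'b::real_normed_vector) \<Rightarrow> bool" where
  "C1_on D F \<longleftrightarrow> (\<forall>x\<in>D. F differentiable (at x)) \<and> continuous_on D (fderiv F)"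

text \<open>Meant for open \<open>D\<close>; values of \<open>F\<close> outside \<open>D\<close> are then irrelevant.\<close>

definition C4_on ::
  "'a::real_normed_vector set \<Rightarrow> ('a \<Rightarrow> 'b::real_normed_vector) \<Rightarrow> bool" where
  "C4_on D F \<longleftrightarrow> C1_on D F \<and> C1_on D (fderiv F) \<and> C1_on D (fderiv (fderiv F))
     \<and> C1_on D (fderiv (fderiv (fderiv F)))"

definition divided_difference ::
  "(real^'m \<Rightarrow> real^'m) \<Rightarrow> real^'m \<Rightarrow> real^'m \<Rightarrow> real^'m^'m" where
  "divided_difference F u v =
     integral {0..1} (\<lambda>t. jacobian F (at (v + t *\<^sub>R (u - v))))"

definition A2 :: "(real^'m \<Rightarrow> real^'m) \<Rightarrow> real^'m \<Rightarrow> real^'m \<Rightarrow> real^'m \<Rightarrow> real^'m" where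
  "A2 F \<alpha> u v =
     (1 / fact 2) *\<^sub>R (matrix_inv (jacobian F (at \<alpha>)) *v
       blinfun_apply (blinfun_apply (fderiv (fderiv F) \<alpha>) u) v)"

definition A3 ::
  "(real^'m \<Rightarrow> real^'m) \<Rightarrow> real^'m \<Rightarrow> real^'m \<Rightarrow> real^'m \<Rightarrow> real^'m \<Rightarrow> real^'m" where
  "A3 F \<alpha> u v w =
     (1 / fact 3) *\<^sub>R (matrix_inv (jacobian F (at \<alpha>)) *v
       blinfun_apply (blinfun_apply (blinfun_apply (fderiv (fderiv (fderiv F)) \<alpha>) u) v) w)"

definition central_dd :: "(real^'m \<Rightarrow> real^'m) \<Rightarrow> real^'m \<Rightarrow> real^'m^'m" where
  "central_dd F x = divided_difference F (x + F x) (x - F x)"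

definition method_y :: "(real^'m \<Rightarrow> real^'m) \<Rightarrow> real^'m \<Rightarrow> real^'m" where
  "method_y F x = x - matrix_inv (central_dd F x) *v F x"

definition nu_denominator :: "(real^'m \<Rightarrow> real^'m) \<Rightarrow> real^'m \<Rightarrow> real^'m^'m" where
  "nu_denominator F x = 2 *\<^sub>R divided_difference F (method_y F x) x - central_dd F x"

definition method_z :: "(real^'m \<Rightarrow> real^'m) \<Rightarrow> real^'m \<Rightarrow> real^'m" where
  "method_z F x =
     method_y F x - matrix_inv (nu_denominator F x) *v F (method_y F x)"

text \<open>
  The points at which one step is well defined.  \<open>matrix_inv\<close> and \<open>F\<close> are total in HOL, so this
  has to be recorded separately.  For convex \<open>D\<close> the segments over which the divided differences
  integrate lie in \<open>D\<close> as soon as their end points do.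
\<close>

definition method_domain :: "(real^'m) set \<Rightarrow> (real^'m \<Rightarrow> real^'m) \<Rightarrow> (real^'m) set" where
  "method_domain D F =
     {x \<in> D. x + F x \<in> D \<and> x - F x \<in> D \<and> invertible (central_dd F x)
        \<and> method_y F x \<in> D \<and> invertible (nu_denominator F x)}"

text \<open>
  Local order of convergence at least \<open>p\<close> at \<open>\<alpha>\<close> of the iteration of \<open>\<Phi>\<close>, a map that is meaningful
  only on \<open>W\<close>: the iterates are well defined when none of them leaves \<open>W\<close>.  The constant \<open>C\<close> is
  uniform in the starting point.
\<close>

definition local_order_at_least ::
  "'a::real_normed_vector set \<Rightarrow> ('a \<Rightarrow> 'a) \<Rightarrow> nat \<Rightarrow> 'a \<Rightarrow> bool" where
  "local_order_at_least W \<Phi> p \<alpha> \<longleftrightarrow>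
     (\<exists>\<delta>>0. \<exists>C. \<forall>x\<^sub>0\<in>ball \<alpha> \<delta>.
        (\<forall>n. (\<Phi> ^^ n) x\<^sub>0 \<in> W) \<and>
        (\<lambda>n. (\<Phi> ^^ n) x\<^sub>0) \<longlonglongrightarrow> \<alpha> \<and>
        (\<forall>n. norm ((\<Phi> ^^ Suc n) x\<^sub>0 - \<alpha>) \<le> C * norm ((\<Phi> ^^ n) x\<^sub>0 - \<alpha>) ^ p))"

end

theory Submission
  imports Defs
begin

text \<open>
  Why the method has order four.  Write \<open>e = x - \<alpha>\<close>, \<open>E = y - \<alpha>\<close>, \<open>P = F'(\<alpha>)\<close>, \<open>Q = F''(\<alpha>)\<close>,
  \<open>R = F'''(\<alpha>)\<close>, \<open>M\<close> for the central divided difference and \<open>N\<close> for the matrix inverted in \<open>\<nu>\<close>.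
  \<open>O(k)\<close> stands for terms of order \<open>k\<close> in the norm of \<open>e\<close>.  Each substep subtracts an inverse matrix
  times a value of \<open>F\<close>; factoring the inverse out of the new error gives

    \<open>E = M\<inverse> (M e - F x)\<close>  and  \<open>z - \<alpha> = N\<inverse> (N E - F y)\<close>.

  which reduces both errors to the residuals in parentheses.  Integrating the Taylor polynomial of \<open>F'\<close> along the segments gives

    \<open>M = P + Q e + 1/2 R(e,e) + 1/6 R(F x,F x) + O(3)\<close>,
    \<open>N = P + Q E - 1/6 R(e,e) - 1/6 R(F x,F x) + O(3)\<close>;

  the choice \<open>2 [y,x] - M\<close> makes the first order term \<open>Q e\<close> cancel in \<open>N\<close>, so that \<open>N = P + O(2)\<close>,
  whereas \<open>M = P + O(1)\<close>.  With \<open>F x = P e + 1/2 Q(e,e) + O(3)\<close> the first residual is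
  \<open>1/2 Q(e,e) + O(3)\<close>, and replacing \<open>M\<inverse>\<close> by \<open>P\<inverse>\<close> costs only \<open>O(1+2)\<close>, whence
  \<open>E = A\<^sub>2(e,e) + O(3)\<close>.  The second residual is

    \<open>1/2 Q(E,E) - 1/6 R(e,e,E) - 1/6 R(F x,F x,E) + O(5)\<close>,

  which is \<open>O(4)\<close>.  Substituting \<open>A\<^sub>2(e,e)\<close> for \<open>E\<close> and \<open>P e\<close> for \<open>F x\<close> alters it by \<open>O(5)\<close>, and
  replacing \<open>N\<inverse>\<close> by \<open>P\<inverse>\<close> costs \<open>O(2+4)\<close>.  This is the error equation, and its right-hand side
  is \<open>O(4)\<close>.

  The lemmas that carry the argument are \<open>divided_difference_expansion\<close>,
  \<open>vanishes_to_order_perturbed_inverse\<close>, \<open>second_residual\<close> and \<open>local_order_at_leastI\<close>.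
\<close>

section \<open>Orders of vanishing\<close>

text \<open>
  The statement \<open>g x = O(\<parallel>x - \<alpha>\<parallel> ^ k)\<close> for vector-valued and operator-valued \<open>g\<close>, with the filter
  \<open>nhds \<alpha>\<close> rather than \<open>at \<alpha>\<close>: the point \<open>\<alpha>\<close> itself is a legitimate start of the iteration, and
  including it makes \<open>vanishes_to_order_compose\<close> hold when the inner map takes the value \<open>\<alpha>\<close>.
\<close>
definition vanishes_to_order ::
  "'a::real_normed_vector \<Rightarrow> nat \<Rightarrow> ('a \<Rightarrow> 'b::real_normed_vector) \<Rightarrow> bool" where
  "vanishes_to_order \<alpha> k g \<longleftrightarrow>
     (\<exists>K. eventually (\<lambda>x. norm (g x) \<le> K * norm (x - \<alpha>) ^ k) (nhds \<alpha>))"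

lemma vanishes_to_orderI:
  assumes "eventually (\<lambda>x. norm (g x) \<le> K * norm (x - \<alpha>) ^ k) (nhds \<alpha>)"
  shows "vanishes_to_order \<alpha> k g"
  using assms unfolding vanishes_to_order_def by blast

lemma vanishes_to_orderE:
  assumes "vanishes_to_order \<alpha> k g"
  obtains K where "K \<ge> 0" "eventually (\<lambda>x. norm (g x) \<le> K * norm (x - \<alpha>) ^ k) (nhds \<alpha>)"
proof -
  obtain K where K: "eventually (\<lambda>x. norm (g x) \<le> K * norm (x - \<alpha>) ^ k) (nhds \<alpha>)"
    using assms unfolding vanishes_to_order_def by blast
  have "eventually (\<lambda>x. norm (g x) \<le> \<bar>K\<bar> * norm (x - \<alpha>) ^ k) (nhds \<alpha>)"
    using K by eventually_elim (meson abs_ge_self mult_right_mono norm_ge_zero order_trans zero_le_power)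
  then show ?thesis using that[of "\<bar>K\<bar>"] by simp
qed

lemma vanishes_to_order_ballE:
  assumes "vanishes_to_order \<alpha> k g"
  obtains K r where "K \<ge> 0" "r > 0"
    "\<And>x. x \<in> ball \<alpha> r \<Longrightarrow> norm (g x) \<le> K * norm (x - \<alpha>) ^ k"
  using assms
  by (elim vanishes_to_orderE) (auto simp: eventually_nhds_metric dist_commute)

lemma vanishes_to_order_eventually_cong:
  assumes "eventually (\<lambda>x. g x = h x) (nhds \<alpha>)"
  shows "vanishes_to_order \<alpha> k g \<longleftrightarrow> vanishes_to_order \<alpha> k h"
proof -
  have "eventually (\<lambda>x. norm (g x) \<le> K * norm (x - \<alpha>) ^ k) (nhds \<alpha>) \<longleftrightarrow>
        eventually (\<lambda>x. norm (h x) \<le> K * norm (x - \<alpha>) ^ k) (nhds \<alpha>)" for K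
    using assms by (intro eventually_cong) (auto elim: eventually_mono)
  then show ?thesis unfolding vanishes_to_order_def by simp
qed

lemma vanishes_to_order_mono:
  assumes "vanishes_to_order \<alpha> l g" "k \<le> l"
  shows "vanishes_to_order \<alpha> k g"
proof -
  obtain K where K: "K \<ge> 0" "eventually (\<lambda>x. norm (g x) \<le> K * norm (x - \<alpha>) ^ l) (nhds \<alpha>)"
    using assms(1) by (rule vanishes_to_orderE)
  have "eventually (\<lambda>x. x \<in> ball \<alpha> 1) (nhds \<alpha>)"
    by (intro eventually_nhds_in_open) auto
  with K(2) have "eventually (\<lambda>x. norm (g x) \<le> K * norm (x - \<alpha>) ^ k) (nhds \<alpha>)"
  proof eventually_elim
    case (elim x)
    have "norm (x - \<alpha>) ^ l \<le> norm (x - \<alpha>) ^ k"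
      using elim(2) assms(2) by (intro power_decreasing) (auto simp: dist_norm norm_minus_commute)
    then show ?case using elim(1) K(1) by (meson mult_left_mono order_trans)
  qed
  then show ?thesis by (rule vanishes_to_orderI)
qed

lemma vanishes_to_order_add:
  assumes "vanishes_to_order \<alpha> k g" "vanishes_to_order \<alpha> k h"
  shows "vanishes_to_order \<alpha> k (\<lambda>x. g x + h x)"
proof -
  obtain K L where
    "eventually (\<lambda>x. norm (g x) \<le> K * norm (x - \<alpha>) ^ k) (nhds \<alpha>)"
    "eventually (\<lambda>x. norm (h x) \<le> L * norm (x - \<alpha>) ^ k) (nhds \<alpha>)"
    using assms unfolding vanishes_to_order_def by blast
  then have "eventually (\<lambda>x. norm (g x + h x) \<le> (K + L) * norm (x - \<alpha>) ^ k) (nhds \<alpha>)"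
    by eventually_elim (auto simp: algebra_simps intro: norm_triangle_le)
  then show ?thesis by (rule vanishes_to_orderI)
qed

lemma vanishes_to_order_bounded_linear:
  assumes "bounded_linear T" "vanishes_to_order \<alpha> k g"
  shows "vanishes_to_order \<alpha> k (\<lambda>x. T (g x))"
proof -
  interpret T: bounded_linear T by fact
  obtain B where B: "B > 0" "\<And>y. norm (T y) \<le> norm y * B" using T.pos_bounded by blast
  obtain K where K: "eventually (\<lambda>x. norm (g x) \<le> K * norm (x - \<alpha>) ^ k) (nhds \<alpha>)"
    using assms(2) unfolding vanishes_to_order_def by blast
  have "eventually (\<lambda>x. norm (T (g x)) \<le> (K * B) * norm (x - \<alpha>) ^ k) (nhds \<alpha>)"
    using K
  proof eventually_elim
    case (elim x)
    have "norm (g x) * B \<le> (K * norm (x - \<alpha>) ^ k) * B"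
      using elim B(1) by (intro mult_right_mono) auto
    then show ?case using B(2)[of "g x"] by (simp add: algebra_simps)
  qed
  then show ?thesis by (rule vanishes_to_orderI)
qed

lemmas vanishes_to_order_scaleR = vanishes_to_order_bounded_linear[OF bounded_linear_scaleR_right]
lemmas vanishes_to_order_minus = vanishes_to_order_bounded_linear[OF bounded_linear_minus[OF bounded_linear_ident]]
lemmas vanishes_to_order_blinfun = vanishes_to_order_bounded_linear[OF blinfun.bounded_linear_right]

lemma vanishes_to_order_diff:
  assumes "vanishes_to_order \<alpha> k g" "vanishes_to_order \<alpha> k h"
  shows "vanishes_to_order \<alpha> k (\<lambda>x. g x - h x)"
  using vanishes_to_order_add[OF assms(1) vanishes_to_order_minus[OF assms(2)]] by simp

lemma vanishes_to_order_apply: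
  assumes "vanishes_to_order \<alpha> k A" "vanishes_to_order \<alpha> l g" "n \<le> k + l"
  shows "vanishes_to_order \<alpha> n (\<lambda>x. blinfun_apply (A x) (g x))"
proof (rule vanishes_to_order_mono[OF _ assms(3)])
  obtain K where K: "K \<ge> 0" "eventually (\<lambda>x. norm (A x) \<le> K * norm (x - \<alpha>) ^ k) (nhds \<alpha>)"
    using assms(1) by (rule vanishes_to_orderE)
  obtain L where L: "L \<ge> 0" "eventually (\<lambda>x. norm (g x) \<le> L * norm (x - \<alpha>) ^ l) (nhds \<alpha>)"
    using assms(2) by (rule vanishes_to_orderE)
  from K(2) L(2)
  have "eventually (\<lambda>x. norm (blinfun_apply (A x) (g x)) \<le> (K * L) * norm (x - \<alpha>) ^ (k + l)) (nhds \<alpha>)"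
  proof eventually_elim
    case (elim x)
    have "norm (blinfun_apply (A x) (g x)) \<le> norm (A x) * norm (g x)" by (rule norm_blinfun)
    also have "\<dots> \<le> (K * norm (x - \<alpha>) ^ k) * (L * norm (x - \<alpha>) ^ l)"
      using elim K(1) by (intro mult_mono) auto
    finally show ?case by (simp add: power_add algebra_simps)
  qed
  then show "vanishes_to_order \<alpha> (k + l) (\<lambda>x. blinfun_apply (A x) (g x))"
    by (rule vanishes_to_orderI)
qed

lemma vanishes_to_order_quadratic:
  assumes "vanishes_to_order \<alpha> k u" "vanishes_to_order \<alpha> l v" "n \<le> k + l"
  shows "vanishes_to_order \<alpha> n (\<lambda>x. blinfun_apply (blinfun_apply Q (u x)) (v x))"
  by (rule vanishes_to_order_apply[OF vanishes_to_order_blinfun[OF assms(1)] assms(2,3)])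

lemma vanishes_to_order_cubic:
  assumes "vanishes_to_order \<alpha> k u" "vanishes_to_order \<alpha> l v" "vanishes_to_order \<alpha> m w"
    and "n \<le> k + l + m"
  shows "vanishes_to_order \<alpha> n (\<lambda>x. blinfun_apply (blinfun_apply (blinfun_apply R (u x)) (v x)) (w x))"
  by (rule vanishes_to_order_apply[OF vanishes_to_order_quadratic[OF assms(1,2) order_refl] assms(3,4)])

lemma vanishes_to_order_self: "vanishes_to_order \<alpha> 1 (\<lambda>x. x - \<alpha>)"
  by (rule vanishes_to_orderI[where K = 1]) simp

lemma vanishes_to_order_tendsto:
  assumes "vanishes_to_order \<alpha> k (\<lambda>x. g x - \<beta>)" "k > 0"
  shows "(g \<longlongrightarrow> \<beta>) (nhds \<alpha>)"
proof -
  obtain K where K: "eventually (\<lambda>x. norm (g x - \<beta>) \<le> K * norm (x - \<alpha>) ^ k) (nhds \<alpha>)"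
    using assms(1) unfolding vanishes_to_order_def by blast
  have "((\<lambda>x. x) \<longlongrightarrow> \<alpha>) (nhds \<alpha>)" by (rule filterlim_ident)
  then have "((\<lambda>x. K * norm (x - \<alpha>) ^ k) \<longlongrightarrow> K * norm (\<alpha> - \<alpha>) ^ k) (nhds \<alpha>)"
    by (intro tendsto_intros)
  then have "((\<lambda>x. K * norm (x - \<alpha>) ^ k) \<longlongrightarrow> 0) (nhds \<alpha>)"
    using assms(2) by (simp add: zero_power)
  then have "((\<lambda>x. g x - \<beta>) \<longlongrightarrow> 0) (nhds \<alpha>)"
    by (rule Lim_null_comparison[OF K])
  then show ?thesis by (simp add: LIM_zero_iff)
qed

text \<open>
  The remainder of \<open>F\<close> at the intermediate point \<open>y\<close> is estimated in this way, with \<open>l = 2\<close>: a third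
  order remainder becomes one of sixth order.
\<close>
lemma vanishes_to_order_compose:
  assumes "vanishes_to_order \<alpha> k g" "vanishes_to_order \<alpha> l (\<lambda>x. u x - \<alpha>)" "l > 0"
  shows "vanishes_to_order \<alpha> (k * l) (\<lambda>x. g (u x))"
proof -
  obtain K where K: "K \<ge> 0" "eventually (\<lambda>x. norm (g x) \<le> K * norm (x - \<alpha>) ^ k) (nhds \<alpha>)"
    using assms(1) by (rule vanishes_to_orderE)
  obtain L where L: "L \<ge> 0" "eventually (\<lambda>x. norm (u x - \<alpha>) \<le> L * norm (x - \<alpha>) ^ l) (nhds \<alpha>)"
    using assms(2) by (rule vanishes_to_orderE)
  have "eventually (\<lambda>x. norm (g (u x)) \<le> K * norm (u x - \<alpha>) ^ k) (nhds \<alpha>)"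
    by (rule eventually_compose_filterlim[OF K(2) vanishes_to_order_tendsto[OF assms(2,3)]])
  with L(2)
  have "eventually (\<lambda>x. norm (g (u x)) \<le> (K * L ^ k) * norm (x - \<alpha>) ^ (k * l)) (nhds \<alpha>)"
  proof eventually_elim
    case (elim x)
    have "K * norm (u x - \<alpha>) ^ k \<le> K * (L * norm (x - \<alpha>) ^ l) ^ k"
      using elim(1) K(1) by (intro mult_left_mono power_mono) auto
    then show ?case using elim(2)
      by (simp add: power_mult_distrib power_mult[symmetric] mult.commute[of l k] algebra_simps)
  qed
  then show ?thesis by (rule vanishes_to_orderI)
qed

section \<open>Taylor expansion along segments\<close>

lemma has_derivative_fderiv:
  assumes "F differentiable (at x)"
  shows "(F has_derivative blinfun_apply (fderiv F x)) (at x)"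
  using assms unfolding fderiv_def
  by (metis bounded_linear_Blinfun_apply frechet_derivative_works has_derivative_bounded_linear)

lemma vanishes_to_order_differentiable:
  assumes "(f has_derivative f') (at \<alpha>)"
  shows "vanishes_to_order \<alpha> 1 (\<lambda>x. f x - f \<alpha>)"
proof -
  have f': "bounded_linear f'" using assms by (rule has_derivative_bounded_linear)
  obtain d where "d > 0" "\<forall>y. norm (y - \<alpha>) < d \<longrightarrow> norm (f y - f \<alpha> - f' (y - \<alpha>)) \<le> 1 * norm (y - \<alpha>)"
    using assms unfolding has_derivative_at_alt by (meson zero_less_one)
  then have "vanishes_to_order \<alpha> 1 (\<lambda>x. f x - f \<alpha> - f' (x - \<alpha>))"
    unfolding vanishes_to_order_def eventually_nhds_metric
    by (intro exI[of _ 1] exI[of _ d]) (auto simp: dist_norm)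
  from vanishes_to_order_add[OF this vanishes_to_order_bounded_linear[OF f' vanishes_to_order_self]]
  show ?thesis by simp
qed

text \<open>
  An expansion of the derivative is integrated to one of the function.  The mean value inequality
  is applied to \<open>t \<mapsto> f (\<alpha> + t h)\<close> minus its expected quadratic polynomial in \<open>t\<close>, and not to the
  corresponding function of \<open>x\<close>: the derivative of \<open>x \<mapsto> H (x - \<alpha>) (x - \<alpha>)\<close> has both
  \<open>H (x - \<alpha>) d\<close> and \<open>H d (x - \<alpha>)\<close>, which agree only for symmetric \<open>H\<close>, whereas along a segment both
  arguments are multiples of \<open>h\<close>.
\<close>
lemma vanishes_to_order_integrate:
  fixes G :: "'a::real_normed_vector \<Rightarrow> 'a \<Rightarrow>\<^sub>L 'b::real_normed_vector"
    and H :: "'a \<Rightarrow>\<^sub>L 'a \<Rightarrow>\<^sub>L 'b"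
  assumes deriv: "eventually (\<lambda>x. (f has_derivative blinfun_apply (G x)) (at x)) (nhds \<alpha>)"
    and rem: "vanishes_to_order \<alpha> k (\<lambda>x. G x - G \<alpha> - blinfun_apply H (x - \<alpha>))"
  shows "vanishes_to_order \<alpha> (Suc k)
    (\<lambda>x. f x - f \<alpha> - blinfun_apply (G \<alpha>) (x - \<alpha>)
       - (1/2) *\<^sub>R blinfun_apply (blinfun_apply H (x - \<alpha>)) (x - \<alpha>))"
proof -
  obtain K r where K: "K \<ge> 0" "r > 0"
    "\<And>x. x \<in> ball \<alpha> r \<Longrightarrow> norm (G x - G \<alpha> - blinfun_apply H (x - \<alpha>)) \<le> K * norm (x - \<alpha>) ^ k"
    using rem by (rule vanishes_to_order_ballE) blast
  obtain s where s: "s > 0" "\<And>x. x \<in> ball \<alpha> s \<Longrightarrow> (f has_derivative blinfun_apply (G x)) (at x)"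
    using deriv by (auto simp: eventually_nhds_metric dist_commute)
  have "norm (f x - f \<alpha> - blinfun_apply (G \<alpha>) (x - \<alpha>)
       - (1/2) *\<^sub>R blinfun_apply (blinfun_apply H (x - \<alpha>)) (x - \<alpha>)) \<le> K * norm (x - \<alpha>) ^ Suc k"
    if x: "x \<in> ball \<alpha> (min r s)" for x
  proof -
    define h where "h = x - \<alpha>"
    define \<phi> where "\<phi> = (\<lambda>t. f (\<alpha> + t *\<^sub>R h) - t *\<^sub>R blinfun_apply (G \<alpha>) h
       - (t^2/2) *\<^sub>R blinfun_apply (blinfun_apply H h) h)"
    define v where "v = (\<lambda>t. blinfun_apply (G (\<alpha> + t *\<^sub>R h) - G \<alpha> - blinfun_apply H (t *\<^sub>R h)) h)"
    have seg: "\<alpha> + t *\<^sub>R h \<in> ball \<alpha> (min r s)" if "t \<in> {0..1}" for t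
    proof -
      have "norm (t *\<^sub>R h) \<le> norm h" using that by (simp add: mult_left_le_one_le)
      then show ?thesis using x by (auto simp: dist_norm h_def norm_minus_commute)
    qed
    have der: "(\<phi> has_derivative (\<lambda>d. d *\<^sub>R v t)) (at t within {0..1})" if "t \<in> {0..1}" for t
    proof -
      have F: "(f has_derivative blinfun_apply (G (\<alpha> + t *\<^sub>R h))) (at (\<alpha> + t *\<^sub>R h))"
        using seg[OF that] by (intro s(2)) simp
      have g: "((\<lambda>t. \<alpha> + t *\<^sub>R h) has_derivative (\<lambda>d. d *\<^sub>R h)) (at t within {0..1})"
        by (auto intro!: derivative_eq_intros)
      have "((\<lambda>t. f (\<alpha> + t *\<^sub>R h)) has_derivative (\<lambda>d. blinfun_apply (G (\<alpha> + t *\<^sub>R h)) (d *\<^sub>R h)))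
          (at t within {0..1})"
        using has_derivative_compose[OF g F] by simp
      moreover have "((\<lambda>t. t *\<^sub>R blinfun_apply (G \<alpha>) h) has_derivative
          (\<lambda>d. d *\<^sub>R blinfun_apply (G \<alpha>) h)) (at t within {0..1})"
        by (auto intro!: derivative_eq_intros)
      moreover have "((\<lambda>t. (t^2/2) *\<^sub>R blinfun_apply (blinfun_apply H h) h) has_derivative
          (\<lambda>d. (t * d) *\<^sub>R blinfun_apply (blinfun_apply H h) h)) (at t within {0..1})"
        by (auto intro!: derivative_eq_intros)
      ultimately show ?thesis unfolding \<phi>_def v_def
        by (rule has_derivative_eq_rhs[OF has_derivative_diff[OF has_derivative_diff]])
          (auto simp: blinfun.bilinear_simps algebra_simps fun_eq_iff)
    qed
    have bound: "onorm (\<lambda>d. d *\<^sub>R v t) \<le> K * norm h ^ Suc k" if t: "t \<in> {0..1}" for t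
    proof -
      have "norm (v t) \<le> norm (G (\<alpha> + t *\<^sub>R h) - G \<alpha> - blinfun_apply H (t *\<^sub>R h)) * norm h"
        unfolding v_def by (rule norm_blinfun)
      also have "\<dots> \<le> (K * norm (t *\<^sub>R h) ^ k) * norm h"
        using K(3)[of "\<alpha> + t *\<^sub>R h"] seg[OF t] by (intro mult_right_mono) auto
      also have "\<dots> \<le> (K * norm h ^ k) * norm h"
        using t K(1) by (intro mult_right_mono mult_left_mono power_mono) (auto simp: mult_left_le_one_le)
      finally have "norm (v t) \<le> K * norm h ^ Suc k" by (simp add: algebra_simps)
      then show ?thesis
        by (intro onorm_le) (metis abs_ge_zero mult.commute mult_left_mono norm_scaleR real_norm_def)
    qed
    have "norm (\<phi> 1 - \<phi> 0) \<le> (K * norm h ^ Suc k) * norm (1 - 0 :: real)"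
      by (rule differentiable_bound[OF _ der bound]) auto
    then show ?thesis by (simp add: \<phi>_def h_def algebra_simps)
  qed
  then show ?thesis
    unfolding vanishes_to_order_def eventually_nhds_metric
    using K(2) s(1) by (intro exI[of _ K] exI[of _ "min r s"]) (auto simp: dist_commute)
qed

section \<open>Matrices as operators and divided differences\<close>

text \<open>
  Matrices enter the estimates as elements of the space in which \<open>fderiv\<close> takes its values, with
  the operator norm.
\<close>
definition matrix_op :: "real^'n^'m \<Rightarrow> (real^'n) \<Rightarrow>\<^sub>L (real^'m)" where
  "matrix_op A = Blinfun ((*v) A)"

lemma matrix_op_apply [simp]: "blinfun_apply (matrix_op A) w = A *v w"
  unfolding matrix_op_def by (simp add: bounded_linear_Blinfun_apply)

lemma matrix_op_diff: "matrix_op (A - B) = matrix_op A - matrix_op B"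
  by (rule blinfun_eqI) (simp add: blinfun.bilinear_simps matrix_vector_mult_diff_rdistrib)

lemma matrix_op_scaleR: "matrix_op (c *\<^sub>R A) = c *\<^sub>R matrix_op A"
  by (rule blinfun_eqI) (simp add: blinfun.bilinear_simps scaleR_matrix_vector_assoc)

lemma matrix_op_jacobian:
  assumes "F differentiable (at x)"
  shows "matrix_op (jacobian F (at x)) = fderiv F x"
proof (rule blinfun_eqI)
  fix w
  have "(F has_derivative (\<lambda>h. jacobian F (at x) *v h)) (at x)"
    using assms jacobian_works by blast
  from has_derivative_unique[OF this has_derivative_fderiv[OF assms]]
  show "blinfun_apply (matrix_op (jacobian F (at x))) w = blinfun_apply (fderiv F x) w"
    by (simp add: fun_eq_iff)
qed

lemma has_integral_quadratic:
  fixes a b c :: "'a::banach"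
  shows "((\<lambda>t. a + t *\<^sub>R b + t^2 *\<^sub>R c) has_integral (a + (1/2) *\<^sub>R b + (1/3) *\<^sub>R c)) {0..1::real}"
proof -
  have "((\<lambda>t. t *\<^sub>R a + (t^2/2) *\<^sub>R b + (t^3/3) *\<^sub>R c) has_vector_derivative
      (a + t *\<^sub>R b + t^2 *\<^sub>R c)) (at t within {0..1})" for t :: real
    unfolding has_vector_derivative_def
    by (rule derivative_eq_intros refl | simp add: algebra_simps power2_eq_square)+
  from fundamental_theorem_of_calculus[OF zero_le_one this] show ?thesis by simp
qed

text \<open>
  The segment from \<open>\<alpha> + q\<close> to \<open>\<alpha> + p\<close> is \<open>\<alpha> + h t\<close> with \<open>h t = q + t (p - q)\<close>, so the second order
  Taylor polynomial of the derivative is quadratic in \<open>t\<close> along it and integrates explicitly: the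
  means of \<open>1\<close>, \<open>t\<close>, \<open>t\<^sup>2\<close> over the unit interval are \<open>1\<close>, \<open>1/2\<close>, \<open>1/3\<close>.  The remainder is bounded
  uniformly in \<open>t\<close>, because \<open>\<parallel>h t\<parallel> \<le> \<parallel>p\<parallel> + \<parallel>q\<parallel>\<close>.
\<close>
lemma divided_difference_expansion:
  fixes F :: "real^'m \<Rightarrow> real^'m"
    and Q :: "(real^'m) \<Rightarrow>\<^sub>L (real^'m) \<Rightarrow>\<^sub>L (real^'m)"
    and R :: "(real^'m) \<Rightarrow>\<^sub>L (real^'m) \<Rightarrow>\<^sub>L (real^'m) \<Rightarrow>\<^sub>L (real^'m)"
  assumes diff: "eventually (\<lambda>x. F differentiable (at x)) (nhds \<alpha>)"
    and cont: "eventually (\<lambda>x. isCont (fderiv F) x) (nhds \<alpha>)"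
    and rem: "vanishes_to_order \<alpha> 3 (\<lambda>x. fderiv F x - fderiv F \<alpha> - Q (x - \<alpha>)
                 - (1/2) *\<^sub>R R (x - \<alpha>) (x - \<alpha>))"
    and p: "vanishes_to_order \<alpha> 1 p" and q: "vanishes_to_order \<alpha> 1 q"
  shows "vanishes_to_order \<alpha> 3
    (\<lambda>x. matrix_op (divided_difference F (\<alpha> + p x) (\<alpha> + q x))
       - (fderiv F \<alpha> + (1/2) *\<^sub>R Q (p x + q x)
          + (1/6) *\<^sub>R (R (q x) (q x) + (1/2) *\<^sub>R (R (q x) (p x) + R (p x) (q x)) + R (p x) (p x))))"
proof -
  define poly where "poly h = fderiv F \<alpha> + Q h + (1/2) *\<^sub>R R h h" for h
  obtain K r where K: "K \<ge> 0" "r > 0"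
    "\<And>x. x \<in> ball \<alpha> r \<Longrightarrow> norm (fderiv F x - fderiv F \<alpha> - Q (x - \<alpha>)
                 - (1/2) *\<^sub>R R (x - \<alpha>) (x - \<alpha>)) \<le> K * norm (x - \<alpha>) ^ 3"
    using rem by (rule vanishes_to_order_ballE) blast
  have "eventually (\<lambda>x. F differentiable (at x) \<and> isCont (fderiv F) x) (nhds \<alpha>)"
    using diff cont by eventually_elim simp
  then obtain s where s: "s > 0" "\<And>x. x \<in> ball \<alpha> s \<Longrightarrow> F differentiable (at x) \<and> isCont (fderiv F) x"
    by (auto simp: eventually_nhds_metric dist_commute)
  obtain L where L: "L \<ge> 0" "eventually (\<lambda>x. norm (p x) \<le> L * norm (x - \<alpha>) ^ 1) (nhds \<alpha>)"
    using p by (rule vanishes_to_orderE)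
  obtain L' where L': "L' \<ge> 0" "eventually (\<lambda>x. norm (q x) \<le> L' * norm (x - \<alpha>) ^ 1) (nhds \<alpha>)"
    using q by (rule vanishes_to_orderE)
  have lim: "(g \<longlongrightarrow> 0) (nhds \<alpha>)" if "vanishes_to_order \<alpha> 1 g" for g :: "real^'m \<Rightarrow> real^'m"
    using vanishes_to_order_tendsto[of \<alpha> 1 g 0] that by simp
  have small: "eventually (\<lambda>x. norm (g x) < min r s) (nhds \<alpha>)"
    if "vanishes_to_order \<alpha> 1 g" for g :: "real^'m \<Rightarrow> real^'m"
    using order_tendstoD(2)[OF tendsto_norm_zero[OF lim[OF that]], of "min r s"] K(2) s(1) by simp
  have bound: "norm (matrix_op (divided_difference F (\<alpha> + a) (\<alpha> + b))
       - (fderiv F \<alpha> + (1/2) *\<^sub>R Q (a + b)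
          + (1/6) *\<^sub>R (R b b + (1/2) *\<^sub>R (R b a + R a b) + R a a))) \<le> K * (norm a + norm b) ^ 3"
    if a: "norm a < min r s" and b: "norm b < min r s" for a b
  proof (rule norm_blinfun_bound)
    show "0 \<le> K * (norm a + norm b) ^ 3" using K(1) by simp
    fix w :: "real^'m"
    define h where "h t = b + t *\<^sub>R (a - b)" for t :: real
    have seg: "h t \<in> ball 0 (min r s)" if "t \<in> {0..1}" for t
    proof -
      have "h t \<in> closed_segment b a"
        using that unfolding closed_segment_def h_def by (force simp: algebra_simps)
      moreover have "closed_segment b a \<subseteq> ball 0 (min r s)"
        using a b by (intro closed_segment_subset) auto
      ultimately show ?thesis by blast
    qed
    have hle: "norm (h t) \<le> norm a + norm b" if "t \<in> {0..1}" for t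
    proof -
      have "h t = (1 - t) *\<^sub>R b + t *\<^sub>R a" by (simp add: h_def algebra_simps)
      also have "norm \<dots> \<le> norm ((1 - t) *\<^sub>R b) + norm (t *\<^sub>R a)" by (rule norm_triangle_ineq)
      also have "\<dots> \<le> norm b + norm a" using that by (intro add_mono) (auto simp: mult_left_le_one_le)
      finally show ?thesis by simp
    qed
    have pt: "\<alpha> + b + t *\<^sub>R (\<alpha> + a - (\<alpha> + b)) = \<alpha> + h t" for t by (simp add: h_def)
    have inb: "\<alpha> + h t \<in> ball \<alpha> r" "\<alpha> + h t \<in> ball \<alpha> s" if "t \<in> {0..1}" for t
      using seg[OF that] by (auto simp: dist_norm)
    have hcont: "continuous_on {0..1} (\<lambda>t. \<alpha> + h t)"
      unfolding h_def by (intro continuous_intros)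
    have "continuous_on (ball \<alpha> s) (fderiv F)"
      using s(2) by (intro continuous_at_imp_continuous_on) auto
    then have "continuous_on {0..1} (\<lambda>t. fderiv F (\<alpha> + h t))"
      by (rule continuous_on_compose2[OF _ hcont]) (use inb in auto)
    then have "continuous_on {0..1} (\<lambda>t. \<chi> i j. blinfun_apply (fderiv F (\<alpha> + h t)) (axis j 1) $ i)"
      by (intro continuous_intros)
    moreover have "jacobian F (at (\<alpha> + h t)) = (\<chi> i j. blinfun_apply (fderiv F (\<alpha> + h t)) (axis j 1) $ i)"
      if "t \<in> {0..1}" for t
      using s(2)[OF inb(2)[OF that]]
      by (simp flip: matrix_op_jacobian add: vec_eq_iff matrix_vector_mul_component inner_axis column_def matrix_vector_mult_basis)
    ultimately have "continuous_on {0..1} (\<lambda>t. jacobian F (at (\<alpha> + h t)))"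
      by (subst continuous_on_cong[OF refl]) auto
    then have integ: "(\<lambda>t. jacobian F (at (\<alpha> + h t))) integrable_on {0..1}"
      by (rule integrable_continuous_interval)
    have lin: "bounded_linear (\<lambda>A::real^'m^'m. A *v w)"
      by (intro linear_conv_bounded_linear[THEN iffD1] linearI)
        (simp_all add: matrix_vector_mult_add_rdistrib scaleR_matrix_vector_assoc)
    have "((\<lambda>t. jacobian F (at (\<alpha> + h t)) *v w) has_integral
        divided_difference F (\<alpha> + a) (\<alpha> + b) *v w) {0..1}"
      using has_integral_linear[OF integrable_integral[OF integ] lin]
      unfolding divided_difference_def pt by (simp add: o_def)
    then have I1: "((\<lambda>t. fderiv F (\<alpha> + h t) w) has_integral
        divided_difference F (\<alpha> + a) (\<alpha> + b) *v w) {0..1}"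
      by (rule has_integral_eq[rotated])
        (use s(2) inb(2) in \<open>simp flip: matrix_op_jacobian\<close>)
    have I2: "((\<lambda>t. poly (h t) w) has_integral
        (fderiv F \<alpha> + (1/2) *\<^sub>R Q (a + b)
          + (1/6) *\<^sub>R (R b b + (1/2) *\<^sub>R (R b a + R a b) + R a a)) w) {0..1}"
    proof -
      have "poly (h t) w = (fderiv F \<alpha> w + Q b w + (1/2) *\<^sub>R R b b w)
          + t *\<^sub>R (Q (a - b) w + (1/2) *\<^sub>R (R b (a - b) w + R (a - b) b w))
          + t^2 *\<^sub>R ((1/2) *\<^sub>R R (a - b) (a - b) w)" for t
        by (simp only: poly_def h_def blinfun.bilinear_simps, simp add: vec_eq_iff field_simps power2_eq_square)
      moreover have "(fderiv F \<alpha> + (1/2) *\<^sub>R Q (a + b)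
          + (1/6) *\<^sub>R (R b b + (1/2) *\<^sub>R (R b a + R a b) + R a a)) w
        = (fderiv F \<alpha> w + Q b w + (1/2) *\<^sub>R R b b w)
          + (1/2) *\<^sub>R (Q (a - b) w + (1/2) *\<^sub>R (R b (a - b) w + R (a - b) b w))
          + (1/3) *\<^sub>R ((1/2) *\<^sub>R R (a - b) (a - b) w)"
        by (simp only: blinfun.bilinear_simps, simp add: vec_eq_iff field_simps)
      ultimately show ?thesis by (simp only: has_integral_quadratic)
    qed
    have "norm (fderiv F (\<alpha> + h t) w - poly (h t) w) \<le> K * (norm a + norm b) ^ 3 * norm w"
      if t: "t \<in> cbox 0 1" for t
    proof -
      have t: "t \<in> {0..1}" using t by simp
      have "fderiv F (\<alpha> + h t) w - poly (h t) w = (fderiv F (\<alpha> + h t) - poly (h t)) w"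
        by (simp add: blinfun.bilinear_simps)
      also have "norm \<dots> \<le> norm (fderiv F (\<alpha> + h t) - poly (h t)) * norm w"
        by (rule norm_blinfun)
      also have "norm (fderiv F (\<alpha> + h t) - poly (h t)) \<le> K * norm (h t) ^ 3"
        using K(3)[OF inb(1)[OF t]] by (simp add: poly_def algebra_simps)
      also have "\<dots> \<le> K * (norm a + norm b) ^ 3"
        using hle[OF t] K(1) by (intro mult_left_mono power_mono) auto
      finally show ?thesis by (simp add: mult_right_mono)
    qed
    from has_integral_bound[OF _ has_integral_diff[OF I1 I2, folded cbox_interval] this]
    show "norm ((matrix_op (divided_difference F (\<alpha> + a) (\<alpha> + b))
       - (fderiv F \<alpha> + (1/2) *\<^sub>R Q (a + b)
          + (1/6) *\<^sub>R (R b b + (1/2) *\<^sub>R (R b a + R a b) + R a a))) w)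
       \<le> K * (norm a + norm b) ^ 3 * norm w"
      using K(1) by (simp add: blinfun.diff_left)
  qed
  have "eventually (\<lambda>x. norm (matrix_op (divided_difference F (\<alpha> + p x) (\<alpha> + q x))
       - (fderiv F \<alpha> + (1/2) *\<^sub>R Q (p x + q x)
          + (1/6) *\<^sub>R (R (q x) (q x) + (1/2) *\<^sub>R (R (q x) (p x) + R (p x) (q x)) + R (p x) (p x))))
       \<le> (K * (L + L') ^ 3) * norm (x - \<alpha>) ^ 3) (nhds \<alpha>)"
    using small[OF p] small[OF q] L(2) L'(2)
  proof eventually_elim
    case (elim x)
    have "(norm (p x) + norm (q x)) ^ 3 \<le> ((L + L') * norm (x - \<alpha>)) ^ 3"
      using elim(3,4) by (intro power_mono) (auto simp: algebra_simps)
    then have "K * (norm (p x) + norm (q x)) ^ 3 \<le> K * ((L + L') * norm (x - \<alpha>)) ^ 3"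
      using K(1) by (rule mult_left_mono)
    also have "\<dots> = (K * (L + L') ^ 3) * norm (x - \<alpha>) ^ 3"
      by (simp add: power_mult_distrib)
    finally show ?case using bound[OF elim(1,2)] by (rule order_trans[rotated])
  qed
  then show ?thesis by (rule vanishes_to_orderI)
qed

section \<open>Perturbed inverses\<close>

lemma matrix_inv_vector:
  fixes A :: "real^'m^'m"
  assumes "invertible A"
  shows "A *v (matrix_inv A *v w) = w" "matrix_inv A *v (A *v w) = w"
proof -
  have "A ** matrix_inv A = mat 1 \<and> matrix_inv A ** A = mat 1"
    using assms unfolding invertible_def matrix_inv_def by (rule someI_ex)
  then show "A *v (matrix_inv A *v w) = w" "matrix_inv A *v (A *v w) = w"
    by (simp_all add: matrix_vector_mul_assoc)
qed

text \<open>
  If \<open>B\<close> bounds the norm of the inverse of \<open>J\<close>, then \<open>\<parallel>w\<parallel> \<le> B \<parallel>J w\<parallel>\<close>.  This lower bound for \<open>J\<close>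
  survives, with \<open>2 B\<close> for \<open>B\<close>, a perturbation of size at most \<open>1 / (2 B)\<close>, and it gives both
  injectivity, hence invertibility, and a uniform bound for the inverses.
\<close>
lemma perturbed_inverse_bound:
  fixes A :: "'a::real_normed_vector \<Rightarrow> real^'m^'m"
  assumes J: "invertible J"
    and A: "vanishes_to_order \<alpha> k (\<lambda>x. matrix_op (A x) - matrix_op J)" "k > 0"
  obtains C where "C > 0" "eventually (\<lambda>x. invertible (A x)
     \<and> (\<forall>w. norm (matrix_inv (A x) *v w) \<le> C * norm w)) (nhds \<alpha>)"
proof -
  obtain B where B: "B > 0" "\<And>w. norm (matrix_inv J *v w) \<le> norm w * B"
    using bounded_linear.pos_bounded[OF matrix_vector_mul_bounded_linear[of "matrix_inv J"]] by blast
  have "((\<lambda>x. matrix_op (A x)) \<longlongrightarrow> matrix_op J) (nhds \<alpha>)"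
    by (rule vanishes_to_order_tendsto[OF A])
  then have "eventually (\<lambda>x. dist (matrix_op (A x)) (matrix_op J) < 1 / (2 * B)) (nhds \<alpha>)"
    using B(1) by (intro tendstoD) auto
  then have "eventually (\<lambda>x. invertible (A x)
     \<and> (\<forall>w. norm (matrix_inv (A x) *v w) \<le> (2 * B) * norm w)) (nhds \<alpha>)"
  proof eventually_elim
    case (elim x)
    have low: "norm w \<le> (2 * B) * norm (A x *v w)" for w
    proof -
      have "norm w \<le> norm (J *v w) * B"
        using B(2)[of "J *v w"] matrix_inv_vector(2)[OF J] by simp
      moreover have "norm (J *v w) \<le> norm (A x *v w) + norm ((matrix_op (A x) - matrix_op J) w)"
        using norm_triangle_ineq4[of "A x *v w" "(A x *v w) - (J *v w)"]
        by (simp add: blinfun.bilinear_simps)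
      moreover have "norm ((matrix_op (A x) - matrix_op J) w) \<le> 1 / (2 * B) * norm w"
        using elim by (intro order_trans[OF norm_blinfun] mult_right_mono) (auto simp: dist_norm)
      ultimately have "norm w \<le> (norm (A x *v w) + 1 / (2 * B) * norm w) * B"
        using B(1) by (meson add_left_mono less_imp_le mult_right_mono order_trans)
      then show ?thesis using B(1) by (simp add: field_simps)
    qed
    have "\<forall>w. A x *v w = 0 \<longrightarrow> w = 0"
    proof (intro allI impI)
      fix w assume "A x *v w = 0"
      then show "w = 0" using low[of w] by simp
    qed
    then have inv: "invertible (A x)"
      using invertible_left_inverse matrix_left_invertible_ker by blast
    moreover have "norm (matrix_inv (A x) *v w) \<le> (2 * B) * norm w" for w
      using low[of "matrix_inv (A x) *v w"] matrix_inv_vector(1)[OF inv] by simp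
    ultimately show ?case by blast
  qed
  then show ?thesis using that[of "2 * B"] B(1) by simp
qed

text \<open>
  This follows from the resolvent identity \<open>A\<inverse> r - J\<inverse> r = - A\<inverse> ((A - J) (J\<inverse> r))\<close> and the uniform
  bound on \<open>A\<inverse>\<close>.
\<close>
lemma vanishes_to_order_perturbed_inverse:
  fixes A :: "'a::real_normed_vector \<Rightarrow> real^'m^'m"
  assumes J: "invertible J"
    and A: "vanishes_to_order \<alpha> k (\<lambda>x. matrix_op (A x) - matrix_op J)" "k > 0"
    and r: "vanishes_to_order \<alpha> l r"
  shows "vanishes_to_order \<alpha> (k + l) (\<lambda>x. matrix_inv (A x) *v r x - matrix_inv J *v r x)"
proof -
  obtain C where C: "C > 0" "eventually (\<lambda>x. invertible (A x)
     \<and> (\<forall>w. norm (matrix_inv (A x) *v w) \<le> C * norm w)) (nhds \<alpha>)"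
    using perturbed_inverse_bound[OF J A] .
  have "vanishes_to_order \<alpha> (k + l)
      (\<lambda>x. (matrix_op (A x) - matrix_op J) (matrix_inv J *v r x))"
    by (rule vanishes_to_order_apply[OF A(1)
      vanishes_to_order_bounded_linear[OF matrix_vector_mul_bounded_linear r] order_refl])
  then obtain K where K: "eventually (\<lambda>x. norm ((matrix_op (A x) - matrix_op J) (matrix_inv J *v r x))
      \<le> K * norm (x - \<alpha>) ^ (k + l)) (nhds \<alpha>)"
    unfolding vanishes_to_order_def by blast
  from C(2) K have "eventually (\<lambda>x. norm (matrix_inv (A x) *v r x - matrix_inv J *v r x)
      \<le> (C * K) * norm (x - \<alpha>) ^ (k + l)) (nhds \<alpha>)"
  proof eventually_elim
    case (elim x)
    let ?d = "(matrix_op (A x) - matrix_op J) (matrix_inv J *v r x)"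
    have "?d = A x *v (matrix_inv J *v r x) - r x"
      by (simp add: blinfun.bilinear_simps matrix_inv_vector[OF J])
    then have "matrix_inv (A x) *v ?d = matrix_inv J *v r x - matrix_inv (A x) *v r x"
      using elim(1) by (simp add: matrix_vector_mult_diff_distrib matrix_inv_vector)
    then have "norm (matrix_inv (A x) *v r x - matrix_inv J *v r x) \<le> C * norm ?d"
      using elim(1) by (metis norm_minus_commute)
    also have "\<dots> \<le> C * (K * norm (x - \<alpha>) ^ (k + l))"
      using elim(2) C(1) by (intro mult_left_mono) auto
    finally show ?case by simp
  qed
  then show ?thesis by (rule vanishes_to_orderI)
qed

section \<open>Local order of an iteration\<close>

text \<open>
  An error of order \<open>p \<ge> 2\<close> makes \<open>\<Phi>\<close> halve the distance to \<open>\<alpha>\<close> on a small ball, so that the iterates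
  stay in the ball and converge.
\<close>
lemma local_order_at_leastI:
  fixes \<Phi> :: "'a::real_normed_vector \<Rightarrow> 'a"
  assumes W: "eventually (\<lambda>x. x \<in> W) (nhds \<alpha>)"
    and err: "vanishes_to_order \<alpha> p (\<lambda>x. \<Phi> x - \<alpha>)" and p: "p \<ge> 2"
  shows "local_order_at_least W \<Phi> p \<alpha>"
proof -
  obtain K r where K: "K \<ge> 0" "r > 0"
    "\<And>x. x \<in> ball \<alpha> r \<Longrightarrow> norm (\<Phi> x - \<alpha>) \<le> K * norm (x - \<alpha>) ^ p"
    using err by (rule vanishes_to_order_ballE) blast
  obtain s where s: "s > 0" "\<And>x. x \<in> ball \<alpha> s \<Longrightarrow> x \<in> W"
    using W by (auto simp: eventually_nhds_metric dist_commute)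
  \<comment> \<open>On this ball \<open>K * norm (x - \<alpha>) ^ p \<le> K * \<delta> * norm (x - \<alpha>) \<le> 1/2 * norm (x - \<alpha>)\<close>; the \<open>+ 1\<close> avoids
    a division by zero.\<close>
  define \<delta> where "\<delta> = min (min r s) (min 1 (1 / (2 * (K + 1))))"
  have \<delta>: "\<delta> > 0" "\<delta> \<le> r" "\<delta> \<le> s" "\<delta> \<le> 1" "\<delta> \<le> 1 / (2 * (K + 1))"
    using K(1,2) s(1) unfolding \<delta>_def by (simp, linarith+)
  have K\<delta>: "K * \<delta> \<le> 1/2"
  proof -
    have "K * \<delta> \<le> (K + 1) * (1 / (2 * (K + 1)))"
      using \<delta> K(1) by (intro mult_mono) auto
    also have "\<dots> = 1/2" using K(1) by (simp add: field_simps)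
    finally show ?thesis .
  qed
  have contr: "norm (\<Phi> x - \<alpha>) \<le> 1/2 * norm (x - \<alpha>)" if x: "x \<in> ball \<alpha> \<delta>" for x
  proof -
    have n: "norm (x - \<alpha>) \<le> \<delta>" using x by (simp add: dist_norm norm_minus_commute)
    have "norm (x - \<alpha>) ^ p \<le> norm (x - \<alpha>) ^ 2"
      using n \<delta>(4) p by (intro power_decreasing) auto
    also have "\<dots> \<le> \<delta> * norm (x - \<alpha>)"
      using n unfolding power2_eq_square by (intro mult_right_mono) auto
    finally have "K * norm (x - \<alpha>) ^ p \<le> (K * \<delta>) * norm (x - \<alpha>)"
      using K(1) by (metis mult.assoc mult_left_mono)
    also have "\<dots> \<le> 1/2 * norm (x - \<alpha>)" using K\<delta> by (intro mult_right_mono) auto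
    finally show ?thesis using K(3)[of x] x \<delta>(2) by simp
  qed
  have main: "(\<forall>n. (\<Phi> ^^ n) x \<in> W) \<and> (\<lambda>n. (\<Phi> ^^ n) x) \<longlonglongrightarrow> \<alpha> \<and>
      (\<forall>n. norm ((\<Phi> ^^ Suc n) x - \<alpha>) \<le> K * norm ((\<Phi> ^^ n) x - \<alpha>) ^ p)"
    if x: "x \<in> ball \<alpha> \<delta>" for x
  proof -
    have geo: "norm ((\<Phi> ^^ n) x - \<alpha>) \<le> (1/2) ^ n * norm (x - \<alpha>) \<and> (\<Phi> ^^ n) x \<in> ball \<alpha> \<delta>" for n
    proof (induction n)
      case 0
      then show ?case using x by simp
    next
      case (Suc n)
      have "norm ((\<Phi> ^^ Suc n) x - \<alpha>) \<le> 1/2 * norm ((\<Phi> ^^ n) x - \<alpha>)"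
        using contr Suc by simp
      moreover have "norm ((\<Phi> ^^ n) x - \<alpha>) < \<delta>"
        using Suc by (simp add: dist_norm norm_minus_commute)
      ultimately have "norm ((\<Phi> ^^ Suc n) x - \<alpha>) < \<delta>"
        "norm ((\<Phi> ^^ Suc n) x - \<alpha>) \<le> 1/2 * ((1/2) ^ n * norm (x - \<alpha>))"
        using Suc norm_ge_zero[of "(\<Phi> ^^ n) x - \<alpha>"] by linarith+
      then show ?case
        by (simp add: dist_norm norm_minus_commute)
    qed
    have "(\<lambda>n. (1/2) ^ n * norm (x - \<alpha>)) \<longlonglongrightarrow> 0"
      by (intro tendsto_mult_left_zero LIMSEQ_power_zero) simp
    then have "(\<lambda>n. (\<Phi> ^^ n) x - \<alpha>) \<longlonglongrightarrow> 0"
      by (rule Lim_null_comparison[rotated]) (use geo in auto)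
    then have "(\<lambda>n. (\<Phi> ^^ n) x) \<longlonglongrightarrow> \<alpha>" by (simp add: LIM_zero_iff)
    moreover have "(\<Phi> ^^ n) x \<in> ball \<alpha> r" "(\<Phi> ^^ n) x \<in> ball \<alpha> s" for n
      using geo[of n] \<delta> by auto
    ultimately show ?thesis using K(3) s(2) by simp
  qed
  then show ?thesis
    unfolding local_order_at_least_def using \<delta>(1) by blast
qed

section \<open>The error of one step\<close>

locale nonsingular_zero =
  fixes D :: "(real^'m) set" and F :: "real^'m \<Rightarrow> real^'m" and \<alpha> :: "real^'m"
  assumes open_D: "open D" and C4: "C4_on D F" and \<alpha>: "\<alpha> \<in> D" "F \<alpha> = 0"
    and invertible_J: "invertible (jacobian F (at \<alpha>))"
begin

abbreviation "J \<equiv> jacobian F (at \<alpha>)"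
abbreviation "P \<equiv> fderiv F \<alpha>"
abbreviation "Q \<equiv> fderiv (fderiv F) \<alpha>"
abbreviation "R \<equiv> fderiv (fderiv (fderiv F)) \<alpha>"
abbreviation "vanishes \<equiv> vanishes_to_order \<alpha>"

definition E :: "real^'m \<Rightarrow> real^'m" where "E x = method_y F x - \<alpha>"
definition a :: "real^'m \<Rightarrow> real^'m" where "a x = A2 F \<alpha> (x - \<alpha>) (x - \<alpha>)"
definition M :: "real^'m \<Rightarrow> (real^'m) \<Rightarrow>\<^sub>L (real^'m)" where "M x = matrix_op (central_dd F x)"
definition N :: "real^'m \<Rightarrow> (real^'m) \<Rightarrow>\<^sub>L (real^'m)" where "N x = matrix_op (nu_denominator F x)"

lemma eventually_in_D:
  assumes "vanishes k (\<lambda>x. g x - \<alpha>)" "k > 0"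
  shows "eventually (\<lambda>x. g x \<in> D) (nhds \<alpha>)"
  using topological_tendstoD[OF vanishes_to_order_tendsto[OF assms] open_D \<alpha>(1)] .

lemma near_\<alpha>: "eventually (\<lambda>x. x \<in> D) (nhds \<alpha>)"
  using open_D \<alpha>(1) by (rule eventually_nhds_in_open)

lemma P_apply: "blinfun_apply P w = J *v w"
proof -
  have "F differentiable (at \<alpha>)" using C4 \<alpha>(1) by (auto simp: C4_on_def C1_on_def)
  then show ?thesis by (simp flip: matrix_op_jacobian)
qed

lemma matrix_op_J: "matrix_op J = P"
  by (rule blinfun_eqI) (simp add: P_apply)

lemma C1_eventually_derivative:
  fixes f :: "real^'m \<Rightarrow> 'b::real_normed_vector"
  assumes "C1_on D f"
  shows "eventually (\<lambda>x. (f has_derivative blinfun_apply (fderiv f x)) (at x)) (nhds \<alpha>)"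
  using near_\<alpha> by eventually_elim (use assms in \<open>auto simp: C1_on_def intro: has_derivative_fderiv\<close>)

text \<open>
  The third derivative is Lipschitz at \<open>\<alpha>\<close>, being differentiable there; two integrations turn this
  into a third order remainder for the first derivative.
\<close>
lemma fderiv_expansion:
  "vanishes 3 (\<lambda>x. fderiv F x - P - Q (x - \<alpha>) - (1/2) *\<^sub>R R (x - \<alpha>) (x - \<alpha>))"
proof -
  have C: "C1_on D (fderiv F)" "C1_on D (fderiv (fderiv F))" "C1_on D (fderiv (fderiv (fderiv F)))"
    using C4 by (auto simp: C4_on_def)
  have "vanishes 1 (\<lambda>x. fderiv (fderiv (fderiv F)) x - R - blinfun_apply 0 (x - \<alpha>))"
    using vanishes_to_order_differentiable[OF eventually_nhds_x_imp_x[OF C1_eventually_derivative[OF C(3)]]]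
    by simp
  from vanishes_to_order_integrate[OF C1_eventually_derivative[OF C(2)] this]
  have "vanishes 2 (\<lambda>x. fderiv (fderiv F) x - Q - R (x - \<alpha>))"
    by (simp add: numeral_2_eq_2)
  from vanishes_to_order_integrate[OF C1_eventually_derivative[OF C(1)] this]
  show ?thesis by (simp add: numeral_3_eq_3)
qed

definition F_remainder :: "real^'m \<Rightarrow> real^'m" where
  "F_remainder x = F x - P (x - \<alpha>) - (1/2) *\<^sub>R Q (x - \<alpha>) (x - \<alpha>)"

lemma F_expansion: "vanishes 3 F_remainder"
proof -
  have C: "C1_on D F" "C1_on D (fderiv F)" "C1_on D (fderiv (fderiv F))"
    using C4 by (auto simp: C4_on_def)
  have "vanishes 1 (\<lambda>x. fderiv (fderiv F) x - Q - blinfun_apply 0 (x - \<alpha>))"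
    using vanishes_to_order_differentiable[OF eventually_nhds_x_imp_x[OF C1_eventually_derivative[OF C(3)]]]
    by simp
  from vanishes_to_order_integrate[OF C1_eventually_derivative[OF C(2)] this]
  have "vanishes 2 (\<lambda>x. fderiv F x - P - Q (x - \<alpha>))"
    by (simp add: numeral_2_eq_2)
  from vanishes_to_order_integrate[OF C1_eventually_derivative[OF C(1)] this]
  show ?thesis by (simp add: numeral_3_eq_3 \<alpha>(2) F_remainder_def[abs_def])
qed

lemma F_linear_part: "vanishes 2 (\<lambda>x. F x - P (x - \<alpha>))"
proof -
  have "vanishes 2 (\<lambda>x. F_remainder x + (1/2) *\<^sub>R Q (x - \<alpha>) (x - \<alpha>))"
    by (intro vanishes_to_order_add vanishes_to_order_scaleR
        vanishes_to_order_mono[OF F_expansion]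
        vanishes_to_order_quadratic[OF vanishes_to_order_self vanishes_to_order_self]) auto
  then show ?thesis by (simp add: F_remainder_def)
qed

lemma F_vanishes: "vanishes 1 F"
proof -
  have "vanishes 1 (\<lambda>x. (F x - P (x - \<alpha>)) + P (x - \<alpha>))"
    by (intro vanishes_to_order_add vanishes_to_order_blinfun vanishes_to_order_self
        vanishes_to_order_mono[OF F_linear_part]) auto
  then show ?thesis by simp
qed

lemma divided_difference_near:
  assumes "vanishes 1 p" "vanishes 1 q"
  shows "vanishes 3
    (\<lambda>x. matrix_op (divided_difference F (\<alpha> + p x) (\<alpha> + q x))
       - (P + (1/2) *\<^sub>R Q (p x + q x)
          + (1/6) *\<^sub>R (R (q x) (q x) + (1/2) *\<^sub>R (R (q x) (p x) + R (p x) (q x)) + R (p x) (p x))))"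
proof (rule divided_difference_expansion[OF _ _ fderiv_expansion assms])
  show "eventually (\<lambda>x. F differentiable (at x)) (nhds \<alpha>)"
    using near_\<alpha> by eventually_elim (use C4 in \<open>auto simp: C4_on_def C1_on_def\<close>)
  show "eventually (\<lambda>x. isCont (fderiv F) x) (nhds \<alpha>)"
    using near_\<alpha> by eventually_elim
      (use C4 open_D in \<open>auto simp: C4_on_def C1_on_def continuous_on_eq_continuous_at\<close>)
qed

text \<open>
  The nodes \<open>x + F x\<close> and \<open>x - F x\<close> are symmetric about \<open>x\<close>, so the terms that are linear in \<open>F x\<close>
  cancel.
\<close>
lemma M_expansion:
  "vanishes 3 (\<lambda>x. M x - (P + Q (x - \<alpha>) + (1/2) *\<^sub>R R (x - \<alpha>) (x - \<alpha>) + (1/6) *\<^sub>R R (F x) (F x)))"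
proof -
  have "vanishes 1 (\<lambda>x. (x - \<alpha>) + F x)" "vanishes 1 (\<lambda>x. (x - \<alpha>) - F x)"
    by (intro vanishes_to_order_add vanishes_to_order_diff vanishes_to_order_self F_vanishes)+
  note * = divided_difference_near[OF this]
  have "(1/2) *\<^sub>R Q (e + f + (e - f)) + (1/6) *\<^sub>R (R (e - f) (e - f)
      + (1/2) *\<^sub>R (R (e - f) (e + f) + R (e + f) (e - f)) + R (e + f) (e + f))
    = Q e + (1/2) *\<^sub>R R e e + (1/6) *\<^sub>R R f f" for e f
    by (rule blinfun_eqI) (simp only: blinfun.bilinear_simps, simp add: vec_eq_iff field_simps)
  from this[of "x - \<alpha>" "F x" for x] * show ?thesis
    unfolding M_def central_dd_def by (simp add: add.assoc)
qed

lemma M_limit: "vanishes 1 (\<lambda>x. M x - P)"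
proof -
  have "vanishes 1 (\<lambda>x. (M x - (P + Q (x - \<alpha>) + (1/2) *\<^sub>R R (x - \<alpha>) (x - \<alpha>) + (1/6) *\<^sub>R R (F x) (F x)))
      + Q (x - \<alpha>) + (1/2) *\<^sub>R R (x - \<alpha>) (x - \<alpha>) + (1/6) *\<^sub>R R (F x) (F x))"
    by (intro vanishes_to_order_add vanishes_to_order_scaleR vanishes_to_order_mono[OF M_expansion]
        vanishes_to_order_quadratic[OF vanishes_to_order_self vanishes_to_order_self]
        vanishes_to_order_quadratic[OF F_vanishes F_vanishes]
        vanishes_to_order_blinfun vanishes_to_order_self) auto
  then show ?thesis by simp
qed

lemma central_dd_invertible: "eventually (\<lambda>x. invertible (central_dd F x)) (nhds \<alpha>)"
  using perturbed_inverse_bound[OF invertible_J M_limit[unfolded M_def matrix_op_J[symmetric]]]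
  by (metis (mono_tags, lifting) eventually_mono zero_less_one)

text \<open>The linear terms cancel, and \<open>Q(e,e)\<close> from \<open>M e\<close> loses the \<open>1/2 Q(e,e)\<close> of \<open>F x\<close>.\<close>
lemma first_residual: "vanishes 3 (\<lambda>x. M x (x - \<alpha>) - F x - (1/2) *\<^sub>R Q (x - \<alpha>) (x - \<alpha>))"
proof -
  have "vanishes 3 (\<lambda>x. (M x - (P + Q (x - \<alpha>) + (1/2) *\<^sub>R R (x - \<alpha>) (x - \<alpha>) + (1/6) *\<^sub>R R (F x) (F x))) (x - \<alpha>)
      + (1/2) *\<^sub>R R (x - \<alpha>) (x - \<alpha>) (x - \<alpha>) + (1/6) *\<^sub>R R (F x) (F x) (x - \<alpha>) - F_remainder x)"
    by (intro vanishes_to_order_add vanishes_to_order_diff vanishes_to_order_scaleR F_expansion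
        vanishes_to_order_apply[OF M_expansion vanishes_to_order_self]
        vanishes_to_order_cubic[OF vanishes_to_order_self vanishes_to_order_self vanishes_to_order_self]
        vanishes_to_order_cubic[OF F_vanishes F_vanishes vanishes_to_order_self]) auto
  moreover have "(m - (P + Q e + (1/2) *\<^sub>R R e e + (1/6) *\<^sub>R R f f)) e
      + (1/2) *\<^sub>R R e e e + (1/6) *\<^sub>R R f f e - (f - P e - (1/2) *\<^sub>R Q e e)
     = m e - f - (1/2) *\<^sub>R Q e e" for m e f
    by (simp only: blinfun.bilinear_simps, simp add: vec_eq_iff field_simps)
  ultimately show ?thesis by (simp only: F_remainder_def)
qed

lemma a_eq: "a x = matrix_inv J *v ((1/2) *\<^sub>R Q (x - \<alpha>) (x - \<alpha>))"
  by (simp add: a_def A2_def fact_2 matrix_vector_mult_scaleR)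

lemma a_vanishes: "vanishes 2 a"
  unfolding a_eq
  by (intro vanishes_to_order_bounded_linear[OF matrix_vector_mul_bounded_linear] vanishes_to_order_scaleR
      vanishes_to_order_quadratic[OF vanishes_to_order_self vanishes_to_order_self]) auto

text \<open>
  In \<open>E = M\<inverse> (M e - F x)\<close> the inverse \<open>M\<inverse>\<close> may be replaced by \<open>J\<inverse>\<close>, since \<open>M - J\<close> has order one and
  the residual has order two.
\<close>
lemma E_expansion: "vanishes 3 (\<lambda>x. E x - a x)"
proof -
  define r where "r x = M x (x - \<alpha>) - F x" for x
  have "vanishes 2 (\<lambda>x. (r x - (1/2) *\<^sub>R Q (x - \<alpha>) (x - \<alpha>)) + (1/2) *\<^sub>R Q (x - \<alpha>) (x - \<alpha>))"
    unfolding r_def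
    by (intro vanishes_to_order_add vanishes_to_order_scaleR vanishes_to_order_mono[OF first_residual]
        vanishes_to_order_quadratic[OF vanishes_to_order_self vanishes_to_order_self]) auto
  then have r: "vanishes 2 r" by simp
  have "vanishes 3 (\<lambda>x. matrix_inv (central_dd F x) *v r x - matrix_inv J *v r x)"
    by (rule vanishes_to_order_mono[OF vanishes_to_order_perturbed_inverse[OF invertible_J
        M_limit[unfolded M_def matrix_op_J[symmetric]] _ r]]) simp_all
  moreover have "vanishes 3 (\<lambda>x. matrix_inv J *v (r x - (1/2) *\<^sub>R Q (x - \<alpha>) (x - \<alpha>)))"
    unfolding r_def
    by (rule vanishes_to_order_bounded_linear[OF matrix_vector_mul_bounded_linear first_residual])
  ultimately have "vanishes 3 (\<lambda>x. (matrix_inv (central_dd F x) *v r x - matrix_inv J *v r x)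
      + matrix_inv J *v (r x - (1/2) *\<^sub>R Q (x - \<alpha>) (x - \<alpha>)))"
    by (rule vanishes_to_order_add)
  moreover have "eventually (\<lambda>x. (matrix_inv (central_dd F x) *v r x - matrix_inv J *v r x)
      + matrix_inv J *v (r x - (1/2) *\<^sub>R Q (x - \<alpha>) (x - \<alpha>)) = E x - a x) (nhds \<alpha>)"
    using central_dd_invertible
  proof eventually_elim
    case (elim x)
    have "matrix_inv (central_dd F x) *v r x = E x"
      by (simp add: r_def M_def E_def method_y_def matrix_vector_mult_diff_distrib matrix_inv_vector[OF elim])
    then show ?case by (simp add: a_eq matrix_vector_mult_diff_distrib)
  qed
  ultimately show ?thesis by (simp only: vanishes_to_order_eventually_cong)
qed

lemma E_vanishes: "vanishes 2 E"
proof -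
  have "vanishes 2 (\<lambda>x. (E x - a x) + a x)"
    by (intro vanishes_to_order_add a_vanishes vanishes_to_order_mono[OF E_expansion]) simp
  then show ?thesis by simp
qed

lemma E_vanishes_1: "vanishes 1 E"
  by (rule vanishes_to_order_mono[OF E_vanishes]) simp

text \<open>
  Doubling \<open>[y,x]\<close> doubles the mean \<open>1/2 Q (E + e)\<close> and so produces exactly the \<open>Q e\<close> of \<open>M\<close>, which
  drops out; \<open>1/3 - 1/2 = - 1/6\<close> is the coefficient left at \<open>R(e,e)\<close>.  The mixed terms
  \<open>R(e,E)\<close>, \<open>R(E,e)\<close> and \<open>R(E,E)\<close> are absorbed, since \<open>E\<close> is of second order.
\<close>
lemma N_expansion:
  "vanishes 3 (\<lambda>x. N x - (P + Q (E x) - (1/6) *\<^sub>R R (x - \<alpha>) (x - \<alpha>) - (1/6) *\<^sub>R R (F x) (F x)))"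
proof -
  define B where "B x = matrix_op (divided_difference F (method_y F x) x)" for x
  have B: "vanishes 3 (\<lambda>x. B x - (P + (1/2) *\<^sub>R Q (E x + (x - \<alpha>))
          + (1/6) *\<^sub>R (R (x - \<alpha>) (x - \<alpha>) + (1/2) *\<^sub>R (R (x - \<alpha>) (E x) + R (E x) (x - \<alpha>)) + R (E x) (E x))))"
    using divided_difference_near[OF E_vanishes_1 vanishes_to_order_self]
    unfolding B_def E_def by simp
  have "vanishes 3 (\<lambda>x. 2 *\<^sub>R (B x - (P + (1/2) *\<^sub>R Q (E x + (x - \<alpha>))
          + (1/6) *\<^sub>R (R (x - \<alpha>) (x - \<alpha>) + (1/2) *\<^sub>R (R (x - \<alpha>) (E x) + R (E x) (x - \<alpha>)) + R (E x) (E x))))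
      - (M x - (P + Q (x - \<alpha>) + (1/2) *\<^sub>R R (x - \<alpha>) (x - \<alpha>) + (1/6) *\<^sub>R R (F x) (F x)))
      + (1/6) *\<^sub>R (R (x - \<alpha>) (E x) + R (E x) (x - \<alpha>)) + (1/3) *\<^sub>R R (E x) (E x))"
    by (intro vanishes_to_order_add vanishes_to_order_diff vanishes_to_order_scaleR B M_expansion
        vanishes_to_order_quadratic[OF vanishes_to_order_self E_vanishes]
        vanishes_to_order_quadratic[OF E_vanishes vanishes_to_order_self]
        vanishes_to_order_quadratic[OF E_vanishes E_vanishes]) auto
  moreover have "2 *\<^sub>R (b - (P + (1/2) *\<^sub>R Q (E' + e)
          + (1/6) *\<^sub>R (R e e + (1/2) *\<^sub>R (R e E' + R E' e) + R E' E')))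
      - (m - (P + Q e + (1/2) *\<^sub>R R e e + (1/6) *\<^sub>R R f f))
      + (1/6) *\<^sub>R (R e E' + R E' e) + (1/3) *\<^sub>R R E' E'
      = (2 *\<^sub>R b - m) - (P + Q E' - (1/6) *\<^sub>R R e e - (1/6) *\<^sub>R R f f)" for b m E' e f
    by (rule blinfun_eqI) (simp only: blinfun.bilinear_simps, simp add: vec_eq_iff field_simps)
  moreover have "N x = 2 *\<^sub>R B x - M x" for x
    by (simp add: N_def B_def M_def nu_denominator_def matrix_op_diff matrix_op_scaleR)
  ultimately show ?thesis by (simp only:)
qed

lemma N_limit: "vanishes 2 (\<lambda>x. N x - P)"
proof -
  have "vanishes 2 (\<lambda>x. (N x - (P + Q (E x) - (1/6) *\<^sub>R R (x - \<alpha>) (x - \<alpha>) - (1/6) *\<^sub>R R (F x) (F x)))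
      + Q (E x) - (1/6) *\<^sub>R R (x - \<alpha>) (x - \<alpha>) - (1/6) *\<^sub>R R (F x) (F x))"
    by (intro vanishes_to_order_add vanishes_to_order_diff vanishes_to_order_scaleR
        vanishes_to_order_mono[OF N_expansion]
        vanishes_to_order_quadratic[OF vanishes_to_order_self vanishes_to_order_self]
        vanishes_to_order_quadratic[OF F_vanishes F_vanishes]
        vanishes_to_order_blinfun E_vanishes) auto
  then show ?thesis by (simp add: algebra_simps)
qed

lemma nu_denominator_invertible: "eventually (\<lambda>x. invertible (nu_denominator F x)) (nhds \<alpha>)"
  using perturbed_inverse_bound[OF invertible_J N_limit[unfolded N_def matrix_op_J[symmetric]]]
  by (metis (mono_tags, lifting) eventually_mono zero_less_numeral)

text \<open>The principal part of the residual \<open>N E - F y\<close>; applying \<open>F'(\<alpha>)\<inverse>\<close> to it gives the error equation.\<close>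
definition leading_error :: "real^'m \<Rightarrow> real^'m" where
  "leading_error x = (1/2) *\<^sub>R Q (a x) (a x) - (1/6) *\<^sub>R R (x - \<alpha>) (x - \<alpha>) (a x)
     - (1/6) *\<^sub>R R (P (x - \<alpha>)) (P (x - \<alpha>)) (a x)"

lemma Pe_vanishes: "vanishes 1 (\<lambda>x. P (x - \<alpha>))"
  by (intro vanishes_to_order_blinfun vanishes_to_order_self)

lemma leading_error_vanishes: "vanishes 4 leading_error"
  unfolding leading_error_def
  by (intro vanishes_to_order_diff vanishes_to_order_scaleR
      vanishes_to_order_quadratic[OF a_vanishes a_vanishes]
      vanishes_to_order_cubic[OF vanishes_to_order_self vanishes_to_order_self a_vanishes]
      vanishes_to_order_cubic[OF Pe_vanishes Pe_vanishes a_vanishes]) auto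

text \<open>
  The residual is \<open>1/2 Q(E,E) - 1/6 R(e,e,E) - 1/6 R(F x,F x,E)\<close> up to fifth order.  Replacing one
  argument at a time, \<open>E\<close> by \<open>a\<close> with error \<open>O(3)\<close> and \<open>F x\<close> by \<open>P e\<close> with error \<open>O(2)\<close>, every difference
  is again of order five.
\<close>
lemma second_residual: "vanishes 5 (\<lambda>x. N x (E x) - F (method_y F x) - leading_error x)"
proof -
  have "vanishes 6 (\<lambda>x. F_remainder (method_y F x))"
    using vanishes_to_order_compose[OF F_expansion, of 2 "method_y F"] E_vanishes
    unfolding E_def by simp
  then have rFy: "vanishes 5 (\<lambda>x. F_remainder (method_y F x))"
    by (rule vanishes_to_order_mono) simp
  have "vanishes 5 (\<lambda>x.
      (N x - (P + Q (E x) - (1/6) *\<^sub>R R (x - \<alpha>) (x - \<alpha>) - (1/6) *\<^sub>R R (F x) (F x))) (E x)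
      - F_remainder (method_y F x)
      + (1/2) *\<^sub>R (Q (E x - a x) (E x) + Q (a x) (E x - a x))
      - (1/6) *\<^sub>R R (x - \<alpha>) (x - \<alpha>) (E x - a x)
      - (1/6) *\<^sub>R (R (F x - P (x - \<alpha>)) (F x) (E x) + R (P (x - \<alpha>)) (F x - P (x - \<alpha>)) (E x)
          + R (P (x - \<alpha>)) (P (x - \<alpha>)) (E x - a x)))"
    by (intro vanishes_to_order_add vanishes_to_order_diff vanishes_to_order_scaleR rFy
        vanishes_to_order_apply[OF N_expansion E_vanishes]
        vanishes_to_order_quadratic[OF E_expansion E_vanishes]
        vanishes_to_order_quadratic[OF a_vanishes E_expansion]
        vanishes_to_order_cubic[OF vanishes_to_order_self vanishes_to_order_self E_expansion]
        vanishes_to_order_cubic[OF F_linear_part F_vanishes E_vanishes]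
        vanishes_to_order_cubic[OF Pe_vanishes F_linear_part E_vanishes]
        vanishes_to_order_cubic[OF Pe_vanishes Pe_vanishes E_expansion]) auto
  \<comment> \<open>The telescoped differences add up to the residual minus \<open>leading_error\<close>; this is a multilinear identity
    in the values of all functions at one point.\<close>
  moreover have "(n - (P + Q E' - (1/6) *\<^sub>R R e e - (1/6) *\<^sub>R R f f)) E'
      - (fy - P E' - (1/2) *\<^sub>R Q E' E')
      + (1/2) *\<^sub>R (Q (E' - a') E' + Q a' (E' - a'))
      - (1/6) *\<^sub>R R e e (E' - a')
      - (1/6) *\<^sub>R (R (f - f0) f E' + R f0 (f - f0) E' + R f0 f0 (E' - a'))
    = n E' - fy - ((1/2) *\<^sub>R Q a' a' - (1/6) *\<^sub>R R e e a' - (1/6) *\<^sub>R R f0 f0 a')" for n E' a' e f f0 fy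
    by (simp only: blinfun.bilinear_simps, simp add: vec_eq_iff field_simps)
  ultimately show ?thesis
    by (simp only: F_remainder_def leading_error_def flip: E_def)
qed

text \<open>
  Here \<open>N\<inverse>\<close> may be replaced by \<open>J\<inverse>\<close>, since \<open>N - J\<close> has order two and the residual has order four.
\<close>
lemma z_expansion: "vanishes 5 (\<lambda>x. method_z F x - \<alpha> - matrix_inv J *v leading_error x)"
proof -
  define r where "r x = N x (E x) - F (method_y F x)" for x
  have "vanishes 4 (\<lambda>x. (r x - leading_error x) + leading_error x)"
    unfolding r_def
    by (intro vanishes_to_order_add leading_error_vanishes vanishes_to_order_mono[OF second_residual]) simp
  then have r: "vanishes 4 r" by simp
  have "vanishes 6 (\<lambda>x. matrix_inv (nu_denominator F x) *v r x - matrix_inv J *v r x)"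
    using vanishes_to_order_perturbed_inverse[OF invertible_J N_limit[unfolded N_def matrix_op_J[symmetric]] _ r]
    by simp
  then have "vanishes 5 (\<lambda>x. matrix_inv (nu_denominator F x) *v r x - matrix_inv J *v r x)"
    by (rule vanishes_to_order_mono) simp
  moreover have "vanishes 5 (\<lambda>x. matrix_inv J *v (r x - leading_error x))"
    unfolding r_def
    by (rule vanishes_to_order_bounded_linear[OF matrix_vector_mul_bounded_linear second_residual])
  ultimately have "vanishes 5 (\<lambda>x. (matrix_inv (nu_denominator F x) *v r x - matrix_inv J *v r x)
      + matrix_inv J *v (r x - leading_error x))"
    by (rule vanishes_to_order_add)
  moreover have "eventually (\<lambda>x. (matrix_inv (nu_denominator F x) *v r x - matrix_inv J *v r x)
      + matrix_inv J *v (r x - leading_error x) = method_z F x - \<alpha> - matrix_inv J *v leading_error x) (nhds \<alpha>)"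
    using nu_denominator_invertible
  proof eventually_elim
    case (elim x)
    have "matrix_inv (nu_denominator F x) *v r x = method_z F x - \<alpha>"
      by (simp add: r_def N_def E_def method_z_def matrix_vector_mult_diff_distrib matrix_inv_vector[OF elim])
    then show ?case by (simp add: matrix_vector_mult_diff_distrib)
  qed
  ultimately show ?thesis by (simp only: vanishes_to_order_eventually_cong)
qed

lemma z_vanishes: "vanishes 4 (\<lambda>x. method_z F x - \<alpha>)"
proof -
  have "vanishes 4 (\<lambda>x. (method_z F x - \<alpha> - matrix_inv J *v leading_error x) + matrix_inv J *v leading_error x)"
    by (intro vanishes_to_order_add vanishes_to_order_mono[OF z_expansion]
        vanishes_to_order_bounded_linear[OF matrix_vector_mul_bounded_linear leading_error_vanishes]) simp
  then show ?thesis by simp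
qed

lemma method_domain_near: "eventually (\<lambda>x. x \<in> method_domain D F) (nhds \<alpha>)"
proof -
  have "vanishes 1 (\<lambda>x. (x - \<alpha>) + F x)" "vanishes 1 (\<lambda>x. (x - \<alpha>) - F x)"
    by (intro vanishes_to_order_add vanishes_to_order_diff vanishes_to_order_self F_vanishes)+
  then have "eventually (\<lambda>x. x + F x \<in> D) (nhds \<alpha>)" "eventually (\<lambda>x. x - F x \<in> D) (nhds \<alpha>)"
    by (auto intro!: eventually_in_D[of 1] simp: algebra_simps)
  moreover have "eventually (\<lambda>x. method_y F x \<in> D) (nhds \<alpha>)"
    using E_vanishes unfolding E_def by (rule eventually_in_D) simp
  ultimately show ?thesis
    using near_\<alpha> central_dd_invertible nu_denominator_invertible
    by eventually_elim (simp add: method_domain_def)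
qed

end

theorem theorem2p1:
  fixes D :: "(real^'m) set" and F :: "real^'m \<Rightarrow> real^'m" and \<alpha> :: "real^'m"
  assumes "open D" and "convex D"
    and "C4_on D F"
    and "\<alpha> \<in> D" and "F \<alpha> = 0"
    and "invertible (jacobian F (at \<alpha>))"
  shows "local_order_at_least (method_domain D F) (method_z F) 4 \<alpha> \<and>
    (\<lambda>x. let e = x - \<alpha>; e' = jacobian F (at \<alpha>) *v e; a = A2 F \<alpha> e e in
        norm (method_z F x - \<alpha> - (A2 F \<alpha> a a - A3 F \<alpha> e e a - A3 F \<alpha> e' e' a)))
      \<in> O[at \<alpha>](\<lambda>x. norm (x - \<alpha>) ^ 5)"
proof
  interpret nonsingular_zero D F \<alpha>
    using assms by unfold_locales
  show "local_order_at_least (method_domain D F) (method_z F) 4 \<alpha>"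
    by (rule local_order_at_leastI[OF method_domain_near z_vanishes]) simp
  obtain K where K: "eventually (\<lambda>x. norm (method_z F x - \<alpha> - matrix_inv J *v leading_error x)
      \<le> K * norm (x - \<alpha>) ^ 5) (nhds \<alpha>)"
    using z_expansion unfolding vanishes_to_order_def by blast
  have "matrix_inv J *v leading_error x = A2 F \<alpha> (a x) (a x) - A3 F \<alpha> (x - \<alpha>) (x - \<alpha>) (a x)
      - A3 F \<alpha> (J *v (x - \<alpha>)) (J *v (x - \<alpha>)) (a x)" for x
    by (simp add: leading_error_def A2_def A3_def P_apply fact_numeral matrix_vector_mult_diff_distrib
        matrix_vector_mult_scaleR)
  with K show "(\<lambda>x. let e = x - \<alpha>; e' = jacobian F (at \<alpha>) *v e; a = A2 F \<alpha> e e in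
        norm (method_z F x - \<alpha> - (A2 F \<alpha> a a - A3 F \<alpha> e e a - A3 F \<alpha> e' e' a)))
      \<in> O[at \<alpha>](\<lambda>x. norm (x - \<alpha>) ^ 5)"
    unfolding Let_def a_def[symmetric]
    by (intro bigoI[of _ K]) (auto simp: eventually_at_filter elim: eventually_mono)
qed

end
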